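(* Let $\alpha\in\mathbb{N}_0$ and $\beta>-1$. For sufficiently smooth functions $y$ on $(-1,1)$, the Jacobi-type differential operator $L_{2\alpha+4,x}^{\alpha,\beta}$ satisfies the recurrence relation $$L_{2\alpha+4,x}^{\alpha,\beta}y(x)=\Big\{(x^2-1)D_x^2+[2\alpha-\beta+1+(2\alpha+\beta+3)x]D_x-\frac{4(\alpha+1)}{x-1}+(\alpha+1)(\alpha+\beta+1)\Big\}L_{2\alpha+2,x}^{\alpha-1,\beta}y(x),$$ where, for $\alpha=0$, the recurrence starts with the operator $$L_{2,x}^{-1,\beta}y(x)=\big\{(x^2-1)D_x^2+(\beta+1)(x-1)D_x\big\}y(x).$$ (The operator $L_{2,x}^{-1,\beta}$ is also obtained by formally taking $\alpha=-1$ in the Jacobi differential operator $L_{2,x}^{\alpha,\beta}=(x^2-1)D_x^2+[\alpha-\beta+(\alpha+\beta+2)x]D_x$.)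
   Context: $\mathbb{N}_0=\{0,1,2,\dots\}$; $D_x^i$ is $i$-fold differentiation with respect to $x$. For $\alpha\in\mathbb{N}_0$ and $\beta>-1$, $$L_{2\alpha+4,x}^{\alpha,\beta}y(x)=\frac{x-1}{(x+1)^{\beta}}D_x^{\alpha+2}\Big\{(x+1)^{\alpha+\beta+2}D_x^{\alpha+2}\big[(x-1)^{\alpha+1}y(x)\big]\Big\},\qquad -1<x<1;$$ thus for $\alpha\ge1$ the operator $L_{2\alpha+2,x}^{\alpha-1,\beta}$ is this expression with $\alpha$ replaced by $\alpha-1$. *)

theory Defs
  imports "HOL-Analysis.Analysis"
begin

text \<open>Existence of the derivatives of order up to \<open>n\<close> at every point of the open interval;
  continuity of the last one is not required. All the operators below are local, so on
  \<open>(-1, 1)\<close> the values of \<open>y\<close> outside the interval play no role.\<close>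

definition times_differentiable_on :: "nat \<Rightarrow> (real \<Rightarrow> real) \<Rightarrow> real set \<Rightarrow> bool" where
  "times_differentiable_on n y S \<longleftrightarrow> (\<forall>k<n. \<forall>x\<in>S. (deriv ^^ k) y differentiable (at x))"

text \<open>The operator \<open>L\<^bsub>2\<alpha>+4,x\<^esub>\<^bsup>\<alpha>,\<beta>\<^esup>\<close>, for \<open>-1 < x < 1\<close>.\<close>

definition jacobi_type_op :: "nat \<Rightarrow> real \<Rightarrow> (real \<Rightarrow> real) \<Rightarrow> real \<Rightarrow> real" where
  "jacobi_type_op \<alpha> \<beta> y x =
     (x - 1) / (x + 1) powr \<beta> *
     (deriv ^^ (\<alpha> + 2))
       (\<lambda>t. (t + 1) powr (real \<alpha> + \<beta> + 2) *
            (deriv ^^ (\<alpha> + 2)) (\<lambda>s. (s - 1) ^ (\<alpha> + 1) * y s) t) x"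

text \<open>The starting operator \<open>L\<^bsub>2,x\<^esub>\<^bsup>-1,\<beta>\<^esup>\<close>.\<close>

definition jacobi_type_start :: "real \<Rightarrow> (real \<Rightarrow> real) \<Rightarrow> real \<Rightarrow> real" where
  "jacobi_type_start \<beta> y x =
     (x\<^sup>2 - 1) * (deriv ^^ 2) y x + (\<beta> + 1) * (x - 1) * deriv y x"

text \<open>The classical Jacobi operator \<open>L\<^bsub>2,x\<^esub>\<^bsup>\<alpha>,\<beta>\<^esup>\<close>; its parameter \<open>\<alpha>\<close> is real, so that \<open>\<alpha> = -1\<close>
  can be inserted.\<close>

definition jacobi_op :: "real \<Rightarrow> real \<Rightarrow> (real \<Rightarrow> real) \<Rightarrow> real \<Rightarrow> real" where
  "jacobi_op \<alpha> \<beta> y x =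
     (x\<^sup>2 - 1) * (deriv ^^ 2) y x + (\<alpha> - \<beta> + (\<alpha> + \<beta> + 2) * x) * deriv y x"

end

theory Submission
  imports Defs
begin

text \<open>
  Shift the index: for \<open>n \<ge> 0\<close> put
  \<open>M\<^sub>n y = (x-1) (x+1)\<^sup>-\<^sup>\<beta> k\<close> with \<open>k = D\<^sup>n\<^sup>+\<^sup>1 h\<close>,
  \<open>h = (x+1)\<^bsup>n+\<beta>+1\<^esup> g\<close> and \<open>g = D\<^sup>n\<^sup>+\<^sup>1 ((x-1)\<^sup>n y)\<close>.
  Then \<open>M\<^sub>n\<^sub>+\<^sub>1\<close> is the Jacobi-type operator with parameter \<open>\<alpha> = n\<close>, and \<open>M\<^sub>0\<close> is the starting operator
  written in divergence form, so one recurrence from \<open>M\<^sub>n\<close> to \<open>M\<^sub>n\<^sub>+\<^sub>1\<close> covers both cases.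

  In passing from \<open>n\<close> to \<open>n + 1\<close>, the extra factor \<open>x - 1\<close> inside the inner derivative is affine, so
  the Leibniz rule for it stops after two terms:
  \<open>D\<^sup>n\<^sup>+\<^sup>2 ((x-1)\<^sup>n\<^sup>+\<^sup>1 y) = (x-1) g' + (n+2) g\<close>.
  Multiplied by \<open>(x+1)\<^bsup>n+\<beta>+2\<^esup>\<close> and expressed through \<open>h\<close>, this becomes
  \<open>(x\<^sup>2-1) h' + ((1-\<beta>) x + 2n+3+\<beta>) h\<close>: the fractional powers have disappeared, and the coefficients
  are polynomials of degree at most two. Hence \<open>D\<^sup>n\<^sup>+\<^sup>2\<close> of it is again a short Leibniz expansion, a
  second order differential operator with polynomial coefficients applied to \<open>k\<close>
  (lemma \<open>shifted_op_Suc\<close>). The stated recurrence is this operator conjugated by the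
  weight \<open>(x-1) (x+1)\<^sup>-\<^sup>\<beta>\<close> (lemma \<open>conjugation_by_weight\<close>).
\<close>

section \<open>Functions with finitely many derivatives on an open set\<close>

lemma times_differentiable_on_0 [simp]: "times_differentiable_on 0 f S"
  by (simp add: times_differentiable_on_def)

lemma times_differentiable_on_Suc:
  "times_differentiable_on (Suc n) f S \<longleftrightarrow>
     (\<forall>x\<in>S. f differentiable (at x)) \<and> times_differentiable_on n (deriv f) S"
  unfolding times_differentiable_on_def
  by (simp add: All_less_Suc2 funpow_Suc_right del: funpow.simps)

lemma times_differentiable_on_mono:
  "times_differentiable_on n f S \<Longrightarrow> m \<le> n \<Longrightarrow> times_differentiable_on m f S"
  by (auto simp: times_differentiable_on_def)

lemma times_differentiable_on_funpow_deriv: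
  assumes "times_differentiable_on (m + n) f S"
  shows "times_differentiable_on n ((deriv ^^ m) f) S"
  unfolding times_differentiable_on_def
proof (intro allI impI ballI)
  fix k x assume "k < n" "x \<in> S"
  then have "(deriv ^^ (k + m)) f differentiable (at x)"
    using assms unfolding times_differentiable_on_def by simp
  then show "(deriv ^^ k) ((deriv ^^ m) f) differentiable (at x)"
    by (simp add: funpow_add)
qed

lemma eventually_nhds_eq_on_open:
  assumes "open S" "\<And>x. x \<in> S \<Longrightarrow> f x = g x" "x \<in> S"
  shows "\<forall>\<^sub>F y in nhds x. f y = g y"
  using assms by (auto simp: eventually_nhds)

lemma funpow_deriv_cong_on_open:
  fixes f g :: "real \<Rightarrow> real"
  assumes "open S" "\<And>x. x \<in> S \<Longrightarrow> f x = g x" "x \<in> S"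
  shows "(deriv ^^ n) f x = (deriv ^^ n) g x"
  using assms(3)
proof (induction n arbitrary: x)
  case (Suc n)
  then show ?case
    by (auto intro!: deriv_cong_ev eventually_nhds_eq_on_open[OF assms(1)])
qed (use assms(2) in simp)

lemma differentiable_cong_on_open:
  fixes f g :: "real \<Rightarrow> real"
  assumes "open S" "\<And>x. x \<in> S \<Longrightarrow> f x = g x" "x \<in> S" "f differentiable (at x)"
  shows "g differentiable (at x)"
  using assms by (metis differentiable_def has_derivative_transform_within_open)

lemma times_differentiable_on_cong:
  assumes "open S" "\<And>x. x \<in> S \<Longrightarrow> f x = g x" "times_differentiable_on n f S"
  shows "times_differentiable_on n g S"
  unfolding times_differentiable_on_def
proof (intro allI impI ballI)
  fix k x assume "k < n" "x \<in> S"
  then show "(deriv ^^ k) g differentiable (at x)"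
    using assms(3) differentiable_cong_on_open[OF assms(1), of "(deriv ^^ k) f" "(deriv ^^ k) g"]
      funpow_deriv_cong_on_open[OF assms(1,2)]
    by (auto simp: times_differentiable_on_def)
qed

lemma times_differentiable_on_SucI:
  assumes "open S" "\<And>x. x \<in> S \<Longrightarrow> (f has_field_derivative f' x) (at x)"
    "times_differentiable_on n f' S"
  shows "times_differentiable_on (Suc n) f S"
  unfolding times_differentiable_on_Suc
proof
  show "\<forall>x\<in>S. f differentiable (at x)"
    using assms(2) real_differentiable_def by blast
  show "times_differentiable_on n (deriv f) S"
    by (rule times_differentiable_on_cong[OF assms(1) _ assms(3)])
      (simp add: DERIV_imp_deriv[OF assms(2)])
qed

lemma times_differentiable_on_has_deriv:
  assumes "times_differentiable_on n f S" "x \<in> S" "k < n"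
  shows "((deriv ^^ k) f has_field_derivative (deriv ^^ Suc k) f x) (at x)"
  using assms by (simp add: times_differentiable_on_def DERIV_deriv_iff_real_differentiable)

lemma times_differentiable_on_add:
  assumes "open S" "times_differentiable_on n f S" "times_differentiable_on n g S"
  shows "times_differentiable_on n (\<lambda>x. f x + g x) S"
  using assms(2,3)
proof (induction n arbitrary: f g)
  case (Suc n)
  show ?case
  proof (rule times_differentiable_on_SucI[OF assms(1)])
    show "((\<lambda>x. f x + g x) has_field_derivative deriv f x + deriv g x) (at x)" if "x \<in> S" for x
      using Suc.prems that
      by (auto simp: times_differentiable_on_Suc DERIV_deriv_iff_real_differentiable
          intro!: DERIV_add)
    show "times_differentiable_on n (\<lambda>x. deriv f x + deriv g x) S"
      using Suc by (simp add: times_differentiable_on_Suc)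
  qed
qed simp

lemma times_differentiable_on_mult:
  assumes "open S" "times_differentiable_on n f S" "times_differentiable_on n g S"
  shows "times_differentiable_on n (\<lambda>x. f x * g x) S"
  using assms(2,3)
proof (induction n arbitrary: f g)
  case (Suc n)
  show ?case
  proof (rule times_differentiable_on_SucI[OF assms(1)])
    show "((\<lambda>x. f x * g x) has_field_derivative deriv f x * g x + deriv g x * f x) (at x)"
      if "x \<in> S" for x
      using Suc.prems that
      by (auto simp: times_differentiable_on_Suc DERIV_deriv_iff_real_differentiable
          intro!: DERIV_mult)
    have "times_differentiable_on n f S" "times_differentiable_on n g S"
      using Suc.prems by (auto elim: times_differentiable_on_mono)
    then show "times_differentiable_on n (\<lambda>x. deriv f x * g x + deriv g x * f x) S"
      using Suc by (auto simp: times_differentiable_on_Suc intro!: times_differentiable_on_add assms)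
  qed
qed simp

lemma times_differentiable_on_const:
  assumes "open S"
  shows "times_differentiable_on n (\<lambda>_. c) S"
proof (induction n arbitrary: c)
  case (Suc n)
  then show ?case
    by (intro times_differentiable_on_SucI[OF assms, where f' = "\<lambda>_. 0"]) auto
qed simp

lemma times_differentiable_on_affine:
  assumes "open S"
  shows "times_differentiable_on n (\<lambda>x. a * x + b) S"
proof (cases n)
  case (Suc m)
  show ?thesis
    unfolding Suc
    by (rule times_differentiable_on_SucI[OF assms, where f' = "\<lambda>_. a"])
      (auto intro!: derivative_eq_intros times_differentiable_on_const assms)
qed simp

lemma times_differentiable_on_power:
  assumes "open S" "times_differentiable_on n f S"
  shows "times_differentiable_on n (\<lambda>x. f x ^ m) S"
  by (induction m) (auto intro!: times_differentiable_on_const times_differentiable_on_mult assms)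

lemma times_differentiable_on_powr:
  assumes "open S" "S \<subseteq> {-1<..}"
  shows "times_differentiable_on n (\<lambda>x. (x + 1) powr c) S"
proof (induction n arbitrary: c)
  case (Suc n)
  show ?case
  proof (rule times_differentiable_on_SucI[OF assms(1)])
    show "((\<lambda>x. (x + 1) powr c) has_field_derivative c * (x + 1) powr (c - 1)) (at x)"
      if "x \<in> S" for x
      using that assms(2) by (auto intro!: derivative_eq_intros)
    show "times_differentiable_on n (\<lambda>x. c * (x + 1) powr (c - 1)) S"
      by (intro times_differentiable_on_mult times_differentiable_on_const assms Suc)
  qed
qed simp

section \<open>Leibniz rules\<close>

lemma funpow_deriv_add:
  assumes "open S" "times_differentiable_on n f S" "times_differentiable_on n g S" "x \<in> S"
  shows "(deriv ^^ n) (\<lambda>x. f x + g x) x = (deriv ^^ n) f x + (deriv ^^ n) g x"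
  using assms(2-)
proof (induction n arbitrary: x)
  case (Suc n)
  have "(deriv ^^ Suc n) (\<lambda>x. f x + g x) x = deriv (\<lambda>x. (deriv ^^ n) f x + (deriv ^^ n) g x) x"
    using Suc times_differentiable_on_mono[OF _ le_SucI[OF order.refl]]
    by (auto intro!: deriv_cong_ev eventually_nhds_eq_on_open[OF assms(1)])
  also have "\<dots> = (deriv ^^ Suc n) f x + (deriv ^^ Suc n) g x"
    using Suc.prems
    by (intro DERIV_imp_deriv DERIV_add times_differentiable_on_has_deriv[where n = "Suc n"]) auto
  finally show ?case .
qed simp

text \<open>All derivatives of an affine factor beyond the first vanish, so only two terms of the Leibniz
  expansion survive. Repeated use of this rule is all that is needed for polynomial
  coefficients.\<close>

lemma funpow_deriv_affine_mult:
  assumes "open S" "times_differentiable_on (Suc n) f S" "x \<in> S"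
  shows "(deriv ^^ Suc n) (\<lambda>x. (a * x + b) * f x) x =
           (a * x + b) * (deriv ^^ Suc n) f x + real (Suc n) * a * (deriv ^^ n) f x"
  using assms(2-)
proof (induction n arbitrary: x)
  case 0
  have "(f has_field_derivative deriv f x) (at x)"
    using times_differentiable_on_has_deriv[OF 0, of 0] by simp
  then have "((\<lambda>x. (a * x + b) * f x) has_field_derivative (a * x + b) * deriv f x + a * f x) (at x)"
    by (auto intro!: derivative_eq_intros)
  then show ?case
    by (simp add: DERIV_imp_deriv)
next
  case (Suc n)
  let ?F = "\<lambda>x. (a * x + b) * (deriv ^^ Suc n) f x + real (Suc n) * a * (deriv ^^ n) f x"
  have "(deriv ^^ Suc (Suc n)) (\<lambda>x. (a * x + b) * f x) x = deriv ?F x"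
    unfolding funpow.simps(2)[of "Suc n"] o_apply
    using Suc times_differentiable_on_mono[OF Suc.prems(1), of "Suc n"]
    by (intro deriv_cong_ev eventually_nhds_eq_on_open[OF assms(1)]) (auto simp del: funpow.simps)
  also have "\<dots> = (a * x + b) * (deriv ^^ Suc (Suc n)) f x
                  + real (Suc (Suc n)) * a * (deriv ^^ Suc n) f x"
  proof (rule DERIV_imp_deriv)
    have "((deriv ^^ Suc n) f has_field_derivative (deriv ^^ Suc (Suc n)) f x) (at x)"
      and "((deriv ^^ n) f has_field_derivative (deriv ^^ Suc n) f x) (at x)"
      using Suc.prems by (intro times_differentiable_on_has_deriv[where n = "Suc (Suc n)"]; simp)+
    then show "(?F has_field_derivative (a * x + b) * (deriv ^^ Suc (Suc n)) f x
                  + real (Suc (Suc n)) * a * (deriv ^^ Suc n) f x) (at x)"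
      by (auto intro!: derivative_eq_intros simp: algebra_simps simp del: funpow.simps)
  qed
  finally show ?case .
qed

section \<open>The operators with shifted index\<close>

text \<open>Splitting off the inner derivative, its weighted form and the outer derivative gives names to
  the functions \<open>g\<close>, \<open>h\<close> and \<open>k\<close> in which the recurrence is computed.\<close>

definition inner_deriv :: "nat \<Rightarrow> (real \<Rightarrow> real) \<Rightarrow> real \<Rightarrow> real" where
  "inner_deriv n y = (deriv ^^ Suc n) (\<lambda>s. (s - 1) ^ n * y s)"

definition weighted_inner :: "nat \<Rightarrow> real \<Rightarrow> (real \<Rightarrow> real) \<Rightarrow> real \<Rightarrow> real" where
  "weighted_inner n \<beta> y t = (t + 1) powr (real n + \<beta> + 1) * inner_deriv n y t"

definition outer_deriv :: "nat \<Rightarrow> real \<Rightarrow> (real \<Rightarrow> real) \<Rightarrow> real \<Rightarrow> real" where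
  "outer_deriv n \<beta> y = (deriv ^^ Suc n) (weighted_inner n \<beta> y)"

definition weight :: "real \<Rightarrow> real \<Rightarrow> real" where
  "weight \<beta> x = (x - 1) * (x + 1) powr (- \<beta>)"

lemma jacobi_type_op_eq: "jacobi_type_op n \<beta> y x = weight \<beta> x * outer_deriv (Suc n) \<beta> y x"
  by (simp add: jacobi_type_op_def weight_def outer_deriv_def weighted_inner_def[abs_def]
      inner_deriv_def powr_minus divide_inverse add_ac)

text \<open>In divergence form the starting operator is
  \<open>(x-1) (x+1)\<^sup>-\<^sup>\<beta> D ((x+1)\<^bsup>\<beta>+1\<^esup> D y)\<close>, which makes it the member \<open>n = 0\<close> of the family.\<close>

lemma jacobi_type_start_eq:
  assumes "times_differentiable_on 2 y {-1<..<1}" "x \<in> {-1<..<1}"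
  shows "jacobi_type_start \<beta> y x = weight \<beta> x * outer_deriv 0 \<beta> y x"
proof -
  have "(deriv y has_field_derivative (deriv ^^ 2) y x) (at x)"
    using times_differentiable_on_has_deriv[OF assms, of 1] by (simp add: numeral_2_eq_2)
  then have "((\<lambda>t. (t + 1) powr (\<beta> + 1) * deriv y t) has_field_derivative
      (\<beta> + 1) * (x + 1) powr \<beta> * deriv y x + (x + 1) powr (\<beta> + 1) * (deriv ^^ 2) y x) (at x)"
    using assms(2) by (auto intro!: derivative_eq_intros)
  then have "outer_deriv 0 \<beta> y x =
      (\<beta> + 1) * (x + 1) powr \<beta> * deriv y x + (x + 1) powr (\<beta> + 1) * (deriv ^^ 2) y x"
    by (simp add: outer_deriv_def weighted_inner_def[abs_def] inner_deriv_def DERIV_imp_deriv)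
  moreover have "(x + 1) powr (\<beta> + 1) = (x + 1) powr \<beta> * (x + 1)"
    using assms(2) by (simp add: powr_add)
  moreover have "(x + 1) powr (- \<beta>) * (x + 1) powr \<beta> = 1"
    using assms(2) by (simp add: powr_minus)
  ultimately show ?thesis
    unfolding jacobi_type_start_def weight_def by algebra
qed

lemma times_differentiable_on_inner_deriv:
  assumes "times_differentiable_on (Suc n + m) y {-1<..<1}"
  shows "times_differentiable_on m (inner_deriv n y) {-1<..<1}"
  unfolding inner_deriv_def
  using times_differentiable_on_affine[of "{-1<..<1}" _ 1 "-1"]
  by (intro times_differentiable_on_funpow_deriv times_differentiable_on_mult
      times_differentiable_on_power assms) auto

lemma times_differentiable_on_weighted_inner:
  assumes "times_differentiable_on (Suc n + m) y {-1<..<1}"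
  shows "times_differentiable_on m (weighted_inner n \<beta> y) {-1<..<1}"
  unfolding weighted_inner_def[abs_def]
  by (intro times_differentiable_on_mult times_differentiable_on_powr
      times_differentiable_on_inner_deriv assms) auto

section \<open>One step of the recurrence\<close>

text \<open>The exponent of \<open>x + 1\<close> exceeds that in the weighted function \<open>h\<close> by one, which is just
  enough to replace both \<open>(x+1)\<^bsup>n+\<beta>+2\<^esup> g'\<close> and \<open>(x+1)\<^bsup>n+\<beta>+2\<^esup> g\<close> by polynomial multiples
  of \<open>h'\<close> and \<open>h\<close>.\<close>

lemma weighted_inner_Suc:
  assumes "times_differentiable_on (n + 2) y {-1<..<1}" "x \<in> {-1<..<1}"
  shows "weighted_inner (Suc n) \<beta> y x =
           (x\<^sup>2 - 1) * deriv (weighted_inner n \<beta> y) x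
           + ((1 - \<beta>) * x + (2 * real n + 3 + \<beta>)) * weighted_inner n \<beta> y x"
proof -
  define f where "f = (\<lambda>s. (s - 1) ^ n * y s)"
  have f: "times_differentiable_on (Suc (Suc n)) f {-1<..<1}"
    unfolding f_def using times_differentiable_on_affine[of "{-1<..<1}" _ 1 "-1"] assms(1)
    by (intro times_differentiable_on_mult times_differentiable_on_power) auto
  have g: "inner_deriv n y = (deriv ^^ Suc n) f"
    by (simp add: inner_deriv_def f_def)
  have g': "(inner_deriv n y has_field_derivative (deriv ^^ Suc (Suc n)) f x) (at x)"
    unfolding g by (rule times_differentiable_on_has_deriv[OF f assms(2)]) simp
  have "inner_deriv (Suc n) y x = (deriv ^^ Suc (Suc n)) (\<lambda>s. (1 * s + (-1)) * f s) x"
    by (simp add: inner_deriv_def f_def mult_ac)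
  also have "\<dots> = (x - 1) * (deriv ^^ Suc (Suc n)) f x + (real n + 2) * inner_deriv n y x"
    using funpow_deriv_affine_mult[OF _ f assms(2), of 1 "-1"] by (simp add: g add_ac)
  finally have inner: "inner_deriv (Suc n) y x = \<dots>" .
  define P where "P = (x + 1) powr (real n + \<beta>)"
  have P1: "(x + 1) powr (real n + \<beta> + 1) = P * (x + 1)"
    and P2: "(x + 1) powr (real (Suc n) + \<beta> + 1) = P * (x + 1) * (x + 1)"
    using assms(2) powr_add[of "x + 1" "real n + \<beta>" 1] powr_add[of "x + 1" "real n + \<beta>" 2]
    by (simp_all add: P_def add_ac power2_eq_square)
  have "(weighted_inner n \<beta> y has_field_derivative
      (real n + \<beta> + 1) * P * inner_deriv n y x + P * (x + 1) * (deriv ^^ Suc (Suc n)) f x) (at x)"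
    unfolding weighted_inner_def[abs_def] P1[symmetric] using g' assms(2)
    by (auto intro!: derivative_eq_intros simp: P_def simp del: funpow.simps)
  then have "deriv (weighted_inner n \<beta> y) x =
      (real n + \<beta> + 1) * P * inner_deriv n y x + P * (x + 1) * (deriv ^^ Suc (Suc n)) f x"
    by (rule DERIV_imp_deriv)
  moreover have "weighted_inner n \<beta> y x = P * (x + 1) * inner_deriv n y x"
    by (simp add: weighted_inner_def P1)
  moreover have "weighted_inner (Suc n) \<beta> y x = P * (x + 1) * (x + 1) * inner_deriv (Suc n) y x"
    unfolding weighted_inner_def P2 ..
  ultimately show ?thesis
    unfolding inner by algebra
qed

lemma shifted_op_Suc:
  fixes \<beta> :: real
  assumes y: "times_differentiable_on (2 * n + 4) y {-1<..<1}" and x: "x \<in> {-1<..<1}"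
  defines "k \<equiv> outer_deriv n \<beta> y"
  shows "outer_deriv (Suc n) \<beta> y x =
           (x\<^sup>2 - 1) * (deriv ^^ 2) k x
           + ((2 * real n + 5 - \<beta>) * x + (2 * real n + 3 + \<beta>)) * deriv k x
           + (real n + 2) * (real n + 2 - \<beta>) * k x"
proof -
  let ?S = "{-1<..<1::real}"
  have S: "open ?S" by simp
  define h where "h = weighted_inner n \<beta> y"
  have "times_differentiable_on (Suc n + (n + 3)) y ?S"
    using y by (rule times_differentiable_on_mono) simp
  then have h: "times_differentiable_on (n + 3) h ?S"
    unfolding h_def by (rule times_differentiable_on_weighted_inner)
  have h': "times_differentiable_on (n + 2) (deriv h) ?S"
    using h by (simp add: times_differentiable_on_Suc numeral_3_eq_3)
  have aff: "times_differentiable_on m (\<lambda>x. a * x + b) ?S" for m a b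
    by (rule times_differentiable_on_affine[OF S])
  have k: "k = (deriv ^^ Suc n) h"
    by (simp add: k_def outer_deriv_def h_def)
  \<comment> \<open>The quadratic coefficient \<open>x\<^sup>2 - 1\<close> enters as a product of two affine factors.\<close>
  have "outer_deriv (Suc n) \<beta> y x =
      (deriv ^^ Suc (Suc n)) (\<lambda>x. (1 * x + (-1)) * ((1 * x + 1) * deriv h x)
        + ((1 - \<beta>) * x + (2 * real n + 3 + \<beta>)) * h x) x"
    unfolding outer_deriv_def
  proof (rule funpow_deriv_cong_on_open[OF S _ x])
    fix t assume t: "t \<in> ?S"
    have "times_differentiable_on (n + 2) y ?S"
      using y by (rule times_differentiable_on_mono) simp
    from weighted_inner_Suc[OF this t]
    show "weighted_inner (Suc n) \<beta> y t = (1 * t + (-1)) * ((1 * t + 1) * deriv h t)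
        + ((1 - \<beta>) * t + (2 * real n + 3 + \<beta>)) * h t"
      by (simp add: h_def power2_eq_square algebra_simps)
  qed
  also have "\<dots> = (deriv ^^ Suc (Suc n)) (\<lambda>x. (1 * x + (-1)) * ((1 * x + 1) * deriv h x)) x
      + (deriv ^^ Suc (Suc n)) (\<lambda>x. ((1 - \<beta>) * x + (2 * real n + 3 + \<beta>)) * h x) x"
    using h h' x
    by (intro funpow_deriv_add[OF S] times_differentiable_on_mult[OF S] aff)
      (auto elim: times_differentiable_on_mono)
  also have "(deriv ^^ Suc (Suc n)) (\<lambda>x. ((1 - \<beta>) * x + (2 * real n + 3 + \<beta>)) * h x) x =
      ((1 - \<beta>) * x + (2 * real n + 3 + \<beta>)) * deriv k x + (real n + 2) * (1 - \<beta>) * k x"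
    using funpow_deriv_affine_mult[OF S times_differentiable_on_mono[OF h] x,
        of "Suc n" "1 - \<beta>" "2 * real n + 3 + \<beta>"]
    by (simp add: k add_ac)
  also have "(deriv ^^ Suc (Suc n)) (\<lambda>x. (1 * x + (-1)) * ((1 * x + 1) * deriv h x)) x =
      (x - 1) * (deriv ^^ Suc (Suc n)) (\<lambda>x. (1 * x + 1) * deriv h x) x
      + (real n + 2) * (deriv ^^ Suc n) (\<lambda>x. (1 * x + 1) * deriv h x) x"
    using h' funpow_deriv_affine_mult[OF S times_differentiable_on_mult[OF S aff] x,
        of "Suc n" "deriv h" 1 "-1" 1 1]
    by (simp add: add_ac)
  also have "(deriv ^^ Suc (Suc n)) (\<lambda>x. (1 * x + 1) * deriv h x) x =
      (x + 1) * (deriv ^^ 2) k x + (real n + 2) * deriv k x"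
    using funpow_deriv_affine_mult[OF S times_differentiable_on_mono[OF h'] x, of "Suc n" 1 1]
    by (simp add: k add_ac funpow_swap1 numeral_2_eq_2)
  also have "(deriv ^^ Suc n) (\<lambda>x. (1 * x + 1) * deriv h x) x =
      (x + 1) * deriv k x + (real n + 1) * k x"
    using funpow_deriv_affine_mult[OF S times_differentiable_on_mono[OF h'] x, of n 1 1]
    by (simp add: k add_ac funpow_swap1)
  finally show ?thesis
    by (simp add: power2_eq_square algebra_simps)
qed

lemma derivs_mult:
  fixes f g :: "real \<Rightarrow> real"
  assumes "open S" "x \<in> S"
    and "\<And>x. x \<in> S \<Longrightarrow> (f has_field_derivative f' x) (at x)"
    and "\<And>x. x \<in> S \<Longrightarrow> (f' has_field_derivative f'' x) (at x)"
    and "times_differentiable_on 2 g S"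
  shows "deriv (\<lambda>x. f x * g x) x = f' x * g x + f x * deriv g x"
    and "(deriv ^^ 2) (\<lambda>x. f x * g x) x = f'' x * g x + 2 * f' x * deriv g x + f x * (deriv ^^ 2) g x"
proof -
  have g: "(g has_field_derivative deriv g t) (at t)"
    "(deriv g has_field_derivative (deriv ^^ 2) g t) (at t)" if "t \<in> S" for t
    using times_differentiable_on_has_deriv[OF assms(5) that, of 0]
      times_differentiable_on_has_deriv[OF assms(5) that, of 1] by (simp_all add: numeral_2_eq_2)
  have d1: "deriv (\<lambda>x. f x * g x) t = f' t * g t + f t * deriv g t" if "t \<in> S" for t
    by (rule DERIV_imp_deriv) (use assms(3) g that in \<open>auto intro!: derivative_eq_intros\<close>)
  then show "deriv (\<lambda>x. f x * g x) x = f' x * g x + f x * deriv g x"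
    using assms(2) .
  have "(deriv ^^ 2) (\<lambda>x. f x * g x) x = deriv (\<lambda>x. f' x * g x + f x * deriv g x) x"
    using d1 assms(2)
    by (auto simp: numeral_2_eq_2 intro!: deriv_cong_ev eventually_nhds_eq_on_open[OF assms(1)])
  also have "\<dots> = f'' x * g x + 2 * f' x * deriv g x + f x * (deriv ^^ 2) g x"
    by (rule DERIV_imp_deriv)
      (use assms(2-4) g in \<open>auto intro!: derivative_eq_intros simp: algebra_simps\<close>)
  finally show "(deriv ^^ 2) (\<lambda>x. f x * g x) x =
      f'' x * g x + 2 * f' x * deriv g x + f x * (deriv ^^ 2) g x" .
qed

text \<open>The fractional powers coming from derivatives of the weight \<open>w\<close> combine to the common factor
  \<open>(x+1)\<^sup>-\<^sup>\<beta>\<close>. The poles at \<open>x = -1\<close> that \<open>w'\<close> and \<open>w''\<close> bring in cancel because the first order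
  coefficient has the value \<open>-2 (\<beta> + 1)\<close> there.\<close>

lemma conjugation_by_weight:
  fixes \<beta> c x :: real
  assumes k: "times_differentiable_on 2 k {-1<..<1}" and x: "x \<in> {-1<..<1}"
  defines "u \<equiv> \<lambda>x. weight \<beta> x * k x"
  shows "(x\<^sup>2 - 1) * (deriv ^^ 2) u x + (2 * c - \<beta> + 1 + (2 * c + \<beta> + 3) * x) * deriv u x
           - 4 * (c + 1) / (x - 1) * u x + (c + 1) * (c + \<beta> + 1) * u x =
         weight \<beta> x * ((x\<^sup>2 - 1) * (deriv ^^ 2) k x
           + ((2 * c + 5 - \<beta>) * x + (2 * c + 3 + \<beta>)) * deriv k x
           + (c + 2) * (c + 2 - \<beta>) * k x)"
proof -
  define w' where "w' = (\<lambda>x::real. (x + 1) powr (- \<beta>) - \<beta> * (x - 1) * (x + 1) powr (- \<beta> - 1))"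
  define w'' where "w'' = (\<lambda>x::real. - 2 * \<beta> * (x + 1) powr (- \<beta> - 1)
      + \<beta> * (\<beta> + 1) * (x - 1) * (x + 1) powr (- \<beta> - 2))"
  have w: "(weight \<beta> has_field_derivative w' t) (at t)" if "t \<in> {-1<..<1}" for t
    using that unfolding weight_def[abs_def] w'_def
    by (auto intro!: derivative_eq_intros simp: algebra_simps)
  have w': "(w' has_field_derivative w'' t) (at t)" if "t \<in> {-1<..<1}" for t
    using that unfolding w'_def w''_def
    by (auto intro!: derivative_eq_intros simp: algebra_simps)
  have u: "deriv u x = w' x * k x + weight \<beta> x * deriv k x"
    "(deriv ^^ 2) u x = w'' x * k x + 2 * w' x * deriv k x + weight \<beta> x * (deriv ^^ 2) k x"
    unfolding u_def
    by (rule derivs_mult[where f = "weight \<beta>" and f' = w' and f'' = w'',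
          OF open_greaterThanLessThan x w w' k]; assumption)+
  define Q q p where "Q = (x + 1) powr (- \<beta>)" and "q = inverse (x + 1)" and "p = inverse (x - 1)"
  have q: "(x + 1) * q = 1" and p: "(x - 1) * p = 1"
    using x by (simp_all add: q_def p_def)
  have Q: "(x + 1) powr (- \<beta> - 1) = Q * q" "(x + 1) powr (- \<beta> - 2) = Q * q * q"
    using x powr_diff[of "x + 1" "- \<beta>" 1] powr_diff[of "x + 1" "- \<beta>" 2]
    by (simp_all add: Q_def q_def divide_inverse power2_eq_square)
  have ww: "weight \<beta> x = (x - 1) * Q" "w' x = Q - \<beta> * (x - 1) * (Q * q)"
    "w'' x = - 2 * \<beta> * (Q * q) + \<beta> * (\<beta> + 1) * (x - 1) * (Q * q * q)"
    by (simp_all add: weight_def w'_def w''_def Q flip: Q_def)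
  have ux: "u x = (x - 1) * Q * k x"
    by (simp add: u_def ww)
  show ?thesis
    unfolding u ww ux divide_inverse p_def[symmetric]
    using q p by algebra
qed

section \<open>The recurrence\<close>

theorem corollary4p4:
  fixes \<alpha> :: nat and \<beta> :: real and y :: "real \<Rightarrow> real"
  assumes "\<beta> > -1"
    and "times_differentiable_on (2 * \<alpha> + 4) y {-1<..<1}"
  shows "(\<forall>x\<in>{-1<..<1}.
           let u = (if \<alpha> = 0 then jacobi_type_start \<beta> y else jacobi_type_op (\<alpha> - 1) \<beta> y)
           in jacobi_type_op \<alpha> \<beta> y x =
                (x\<^sup>2 - 1) * (deriv ^^ 2) u x
                + (2 * real \<alpha> - \<beta> + 1 + (2 * real \<alpha> + \<beta> + 3) * x) * deriv u x
                - 4 * (real \<alpha> + 1) / (x - 1) * u x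
                + (real \<alpha> + 1) * (real \<alpha> + \<beta> + 1) * u x)
         \<and> (\<forall>x\<in>{-1<..<1}. jacobi_type_start \<beta> y x = jacobi_op (-1) \<beta> y x)"
proof (intro conjI ballI)
  fix x :: real assume x: "x \<in> {-1<..<1}"
  define u where "u = (if \<alpha> = 0 then jacobi_type_start \<beta> y else jacobi_type_op (\<alpha> - 1) \<beta> y)"
  define k where "k = outer_deriv \<alpha> \<beta> y"
  have u_eq: "u t = weight \<beta> t * k t" if "t \<in> {-1<..<1}" for t
  proof (cases \<alpha>)
    case 0
    have "times_differentiable_on 2 y {-1<..<1}"
      using assms(2) by (rule times_differentiable_on_mono) simp
    from jacobi_type_start_eq[OF this that] show ?thesis
      by (simp add: u_def k_def 0)
  qed (simp add: u_def k_def jacobi_type_op_eq)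
  have derivs: "(deriv ^^ m) u x = (deriv ^^ m) (\<lambda>t. weight \<beta> t * k t) x" for m
    by (rule funpow_deriv_cong_on_open[OF open_greaterThanLessThan u_eq x])
  have "times_differentiable_on (Suc \<alpha> + (Suc \<alpha> + 2)) y {-1<..<1}"
    using assms(2) by (rule times_differentiable_on_mono) simp
  then have k: "times_differentiable_on 2 k {-1<..<1}"
    unfolding k_def outer_deriv_def
    by (intro times_differentiable_on_funpow_deriv times_differentiable_on_weighted_inner)
  have "jacobi_type_op \<alpha> \<beta> y x =
      (x\<^sup>2 - 1) * (deriv ^^ 2) u x
      + (2 * real \<alpha> - \<beta> + 1 + (2 * real \<alpha> + \<beta> + 3) * x) * deriv u x
      - 4 * (real \<alpha> + 1) / (x - 1) * u x
      + (real \<alpha> + 1) * (real \<alpha> + \<beta> + 1) * u x"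
    using derivs[of 1] derivs[of 2] u_eq[OF x] conjugation_by_weight[OF k x, of \<beta> "real \<alpha>"]
      shifted_op_Suc[OF assms(2) x, of \<beta>, folded k_def]
    by (simp add: jacobi_type_op_eq)
  then show "let u = (if \<alpha> = 0 then jacobi_type_start \<beta> y else jacobi_type_op (\<alpha> - 1) \<beta> y)
       in jacobi_type_op \<alpha> \<beta> y x =
            (x\<^sup>2 - 1) * (deriv ^^ 2) u x
            + (2 * real \<alpha> - \<beta> + 1 + (2 * real \<alpha> + \<beta> + 3) * x) * deriv u x
            - 4 * (real \<alpha> + 1) / (x - 1) * u x
            + (real \<alpha> + 1) * (real \<alpha> + \<beta> + 1) * u x"
    unfolding Let_def u_def .
next
  fix x :: real
  show "jacobi_type_start \<beta> y x = jacobi_op (-1) \<beta> y x"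
    by (simp add: jacobi_type_start_def jacobi_op_def algebra_simps)
qed

end
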